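(* Let $p\equiv1\pmod 4$ be a prime. Then $$ {}_2F_1\bigg[\begin{matrix}\frac12&\frac12\\&1\end{matrix}\bigg|\,-1\bigg]_{p-1}\equiv p^2\cdot{}_3F_2\bigg[\begin{matrix}1&1&1\\&\frac32&\frac32\end{matrix}\bigg|\,-1\bigg]_{p-1}\pmod{p^2}, $$ equivalently $\sum_{k=0}^{p-1}\big(\frac{(\frac12)_k}{k!}\big)^2(-1)^k\equiv p^2\sum_{k=\frac{p-1}2}^{p-1}\big(\frac{k!}{(\frac32)_k}\big)^2(-1)^k\pmod{p^2}$.
   Context: Pochhammer symbol: $(x)_0=1$, $(x)_k=x(x+1)\cdots(x+k-1)$. For $n\ge 0$ the truncated hypergeometric series is ${}_{m+1}F_m\Big[\begin{matrix}\alpha_0&\alpha_1&\ldots&\alpha_m\\&\beta_1&\ldots&\beta_m\end{matrix}\Big|\,z\Big]_n=\sum_{k=0}^{n}\frac{(\alpha_0)_k\cdots(\alpha_m)_k}{(\beta_1)_k\cdots(\beta_m)_k}\cdot\frac{z^k}{k!}$. For rational numbers $x,y$, $x\equiv y\pmod{p^2}$ means $x-y\in p^2\mathbb Z_p$ (i.e. $(x-y)/p^2$ has denominator prime to $p$). *)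

theory Defs
  imports Complex_Main "HOL-Computational_Algebra.Primes" "HOL-Number_Theory.Cong"
begin

text \<open>
  Truncated hypergeometric series: the list \<open>as\<close> holds all upper parameters
  (\<open>m + 1\<close> of them in the \<open>m+1Fm\<close> notation), \<open>bs\<close> the lower ones without the
  implicit \<open>1\<close> that produces \<open>k!\<close>. The sum includes \<open>k = n\<close>. Lower parameters in
  \<open>{0, -1, ..., 1 - n}\<close> would lead to divisions by zero and are not meant.
\<close>

definition trunc_hypergeo :: "'a::field_char_0 list \<Rightarrow> 'a list \<Rightarrow> 'a \<Rightarrow> nat \<Rightarrow> 'a" where
  "trunc_hypergeo as bs z n =
     (\<Sum>k=0..n. (\<Prod>a\<leftarrow>as. pochhammer a k) / (\<Prod>b\<leftarrow>bs. pochhammer b k) * (z ^ k / fact k))"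

text \<open>
  For prime \<open>p\<close>, these are the rationals lying in the \<open>p\<close>-adic integers;
  \<open>quotient_of\<close> yields the fraction in lowest terms with positive denominator.
\<close>

definition p_integral :: "nat \<Rightarrow> rat \<Rightarrow> bool" where
  "p_integral p x \<longleftrightarrow> coprime (snd (quotient_of x)) (int p)"

text \<open>
  Congruence of rationals modulo \<open>p ^ e\<close> in the localised sense \<open>x - y \<in> p ^ e Z_p\<close>;
  the library's \<open>cong\<close> does not express this, as every non-zero rational is a unit.
\<close>

definition rat_cong_prime_power :: "nat \<Rightarrow> nat \<Rightarrow> rat \<Rightarrow> rat \<Rightarrow> bool" where
  "rat_cong_prime_power p e x y \<longleftrightarrow> p_integral p ((x - y) / of_nat p ^ e)"

end

theory Submission
  imports Defs
begin

text \<open>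
  Write \<open>p = 2 n + 1\<close>, \<open>a\<^sub>k = (1/2)\<^sub>k / k!\<close> and \<open>b\<^sub>k = p k! / (3/2)\<^sub>k\<close>. Modulo \<open>p\<^sup>2\<close> only
  \<open>k \<le> n\<close> matters for the \<open>a\<^sub>k\<^sup>2\<close> and only \<open>k \<ge> n\<close> for the \<open>b\<^sub>k\<^sup>2\<close>. Starting from the exact
  identity \<open>b\<^sub>n a\<^sub>n = 1\<close>, the term ratios give \<open>b\<^bsub>n+i\<^esub> a\<^bsub>n-i\<^esub> \<equiv> a\<^sub>i\<^sup>2\<close> modulo \<open>p\<^sup>2\<close>, because
  \<open>((2i+1)\<^sup>2 - p\<^sup>2) / ((2i+2)\<^sup>2 - p\<^sup>2) \<equiv> ((2i+1) / (2i+2))\<^sup>2\<close>. In the same way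
  \<open>a\<^bsub>n-i\<^esub> \<equiv> a\<^sub>n a\<^sub>i\<close> modulo \<open>p\<close>, so \<open>a\<^bsub>n-i\<^esub>\<^sup>2 \<equiv> a\<^sub>i\<^sup>2\<close>. Together these give
  \<open>b\<^bsub>n+i\<^esub>\<^sup>2 \<equiv> 2 a\<^sub>i\<^sup>2 - a\<^bsub>n-i\<^esub>\<^sup>2\<close> modulo \<open>p\<^sup>2\<close>, and since \<open>n\<close> is even, the alternating sum of the
  right-hand side over \<open>i\<close> is that of \<open>a\<^sub>i\<^sup>2\<close>.
\<close>

section \<open>The ring of \<open>p\<close>-integral rationals\<close>

text \<open>The reduced denominator divides every other denominator, so any representation with
  denominator prime to \<open>p\<close> will do. Closure under the ring operations can then be read
  off from unreduced fractions.\<close>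

lemma p_integral_iff_fraction:
  "p_integral p x \<longleftrightarrow> (\<exists>a b. x = of_int a / of_int b \<and> coprime b (int p) \<and> b \<noteq> 0)"
proof
  assume "p_integral p x"
  moreover obtain c d where cd: "quotient_of x = (c, d)" by fastforce
  ultimately have "coprime d (int p)" by (simp add: p_integral_def)
  moreover have "x = of_int c / of_int d" using cd by (rule quotient_of_div)
  moreover have "d \<noteq> 0" using quotient_of_denom_pos[OF cd] by simp
  ultimately show "\<exists>a b. x = of_int a / of_int b \<and> coprime b (int p) \<and> b \<noteq> 0" by blast
next
  assume "\<exists>a b. x = of_int a / of_int b \<and> coprime b (int p) \<and> b \<noteq> 0"
  then obtain a b where ab: "x = of_int a / of_int b" "coprime b (int p)" "b \<noteq> 0" by blast
  obtain c d where cd: "quotient_of x = (c, d)" by fastforce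
  have d: "d > 0" "coprime c d" and x: "x = of_int c / of_int d"
    using quotient_of_denom_pos[OF cd] quotient_of_coprime[OF cd] quotient_of_div[OF cd] by auto
  have "of_int (a * d) = (of_int (c * b) :: rat)"
    using ab x d by (simp add: field_simps)
  then have "a * d = c * b" by (simp only: of_int_eq_iff)
  then have "d dvd c * b" by (metis dvd_triv_right)
  then have "d dvd b" using d(2) by (simp add: coprime_commute coprime_dvd_mult_right_iff)
  then have "coprime d (int p)" using coprime_divisors[OF _ dvd_refl ab(2)] by simp
  then show "p_integral p x" using cd by (simp add: p_integral_def)
qed

lemma p_integral_fraction:
  "coprime b (int p) \<Longrightarrow> b \<noteq> 0 \<Longrightarrow> p_integral p (of_int a / of_int b)"
  by (auto simp: p_integral_iff_fraction)

lemma p_integral_of_int [simp]: "p_integral p (of_int a)"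
  using p_integral_fraction[of 1 p a] by simp

lemma p_integral_numerals [simp]:
  "p_integral p 0" "p_integral p 1" "p_integral p (numeral m)" "p_integral p (of_nat k)"
  using p_integral_of_int[of p 0] p_integral_of_int[of p 1] p_integral_of_int[of p "numeral m"]
    p_integral_of_int[of p "int k"] by simp_all

lemma p_integral_add [intro]:
  assumes "p_integral p x" "p_integral p y"
  shows "p_integral p (x + y)"
proof -
  obtain a b c d where "x = of_int a / of_int b" "coprime b (int p)" "b \<noteq> 0"
    "y = of_int c / of_int d" "coprime d (int p)" "d \<noteq> 0"
    using assms by (auto simp: p_integral_iff_fraction)
  then show ?thesis
    using p_integral_fraction[of "b * d" p "a * d + c * b"] by (simp add: add_frac_eq)
qed

lemma p_integral_mult [intro]:
  assumes "p_integral p x" "p_integral p y"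
  shows "p_integral p (x * y)"
proof -
  obtain a b c d where "x = of_int a / of_int b" "coprime b (int p)" "b \<noteq> 0"
    "y = of_int c / of_int d" "coprime d (int p)" "d \<noteq> 0"
    using assms by (auto simp: p_integral_iff_fraction)
  then show ?thesis
    using p_integral_fraction[of "b * d" p "a * c"] by simp
qed

lemma p_integral_minus [intro]: "p_integral p x \<Longrightarrow> p_integral p (- x)"
  using p_integral_mult[OF p_integral_of_int[of p "-1"]] by simp

lemma p_integral_diff [intro]: "p_integral p x \<Longrightarrow> p_integral p y \<Longrightarrow> p_integral p (x - y)"
  using p_integral_add[of p x "- y"] by auto

lemma p_integral_power [intro]: "p_integral p x \<Longrightarrow> p_integral p (x ^ k)"
  by (induction k) auto

section \<open>Calculus of congruences modulo \<open>p ^ e\<close>\<close>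

lemma rat_cong_prime_power_refl [simp]: "rat_cong_prime_power p e x x"
  by (simp add: rat_cong_prime_power_def)

lemma rat_cong_prime_power_sym:
  "rat_cong_prime_power p e x y \<Longrightarrow> rat_cong_prime_power p e y x"
  unfolding rat_cong_prime_power_def by (drule p_integral_minus) (simp add: diff_divide_distrib)

lemma rat_cong_prime_power_add:
  "rat_cong_prime_power p e x y \<Longrightarrow> rat_cong_prime_power p e z w
    \<Longrightarrow> rat_cong_prime_power p e (x + z) (y + w)"
  unfolding rat_cong_prime_power_def
  by (drule (1) p_integral_add) (simp add: diff_divide_distrib add_divide_distrib algebra_simps)

lemma rat_cong_prime_power_trans [trans]:
  "rat_cong_prime_power p e x y \<Longrightarrow> rat_cong_prime_power p e y z
    \<Longrightarrow> rat_cong_prime_power p e x z"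
  unfolding rat_cong_prime_power_def
  by (drule (1) p_integral_add) (simp add: diff_divide_distrib)

lemma rat_cong_prime_power_sum:
  "(\<And>k. k \<in> A \<Longrightarrow> rat_cong_prime_power p e (f k) (g k))
    \<Longrightarrow> rat_cong_prime_power p e (sum f A) (sum g A)"
  by (induction A rule: infinite_finite_induct) (auto intro: rat_cong_prime_power_add)

text \<open>Expand \<open>x * y - x' * y'\<close> around \<open>x'\<close> and \<open>y'\<close>.
  Integrality of the right-hand factors suffices, so exact but unwieldy expressions can stand on the
  left.\<close>

lemma rat_cong_prime_power_mult:
  assumes "p > 0" "rat_cong_prime_power p e x x'" "rat_cong_prime_power p e y y'"
    and "p_integral p x'" "p_integral p y'"
  shows "rat_cong_prime_power p e (x * y) (x' * y')"
proof -
  define q where "q = (of_nat p ^ e :: rat)"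
  have q: "q \<noteq> 0" "p_integral p q" using \<open>p > 0\<close> by (auto simp: q_def)
  have "p_integral p (((x - x') / q) * ((y - y') / q) * q + ((x - x') / q) * y' + x' * ((y - y') / q))"
    using assms q(2) unfolding rat_cong_prime_power_def q_def[symmetric]
    by (intro p_integral_add p_integral_mult)
  also have "((x - x') / q) * ((y - y') / q) * q + ((x - x') / q) * y' + x' * ((y - y') / q)
      = (x * y - x' * y') / q"
    using q(1) by (simp add: field_simps)
  finally show ?thesis by (simp add: rat_cong_prime_power_def q_def)
qed

lemma rat_cong_prime_power_square_0:
  "rat_cong_prime_power p 1 x 0 \<Longrightarrow> rat_cong_prime_power p 2 (x\<^sup>2) 0"
  unfolding rat_cong_prime_power_def by (drule p_integral_power[of _ _ 2]) (simp add: power_divide)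

text \<open>With \<open>P = p ^ e\<close> the difference of the fractions is
  \<open>P * (A - B) / (B * (B - P))\<close>, and \<open>B - P\<close> is prime to \<open>p\<close>
  because it agrees with \<open>B\<close> modulo \<open>p\<close>.\<close>

lemma rat_cong_prime_power_shifted_fraction:
  assumes "p > 0" "e > 0" "coprime B (int p)" "B \<noteq> 0" "B \<noteq> int p ^ e"
  shows "rat_cong_prime_power p e ((of_int A - of_nat p ^ e) / (of_int B - of_nat p ^ e)) (of_int A / of_int B)"
proof -
  define P where "P = int p ^ e"
  have P: "of_nat p ^ e = (of_int P :: rat)" "P \<noteq> 0" using \<open>p > 0\<close> by (simp_all add: P_def)
  have "coprime (B - P) (int p)"
  proof -
    have "int p dvd P" using \<open>e > 0\<close> by (simp add: P_def dvd_power)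
    then have "(B - P) mod int p = B mod int p" by (simp add: mod_eq_dvd_iff)
    then show ?thesis using assms(3) \<open>p > 0\<close> by (metis coprime_mod_left_iff of_nat_0_less_iff less_irrefl)
  qed
  then have "p_integral p (of_int (A - B) / of_int (B * (B - P)))"
    using assms by (intro p_integral_fraction) (auto simp: P_def)
  also have "of_int (A - B) / of_int (B * (B - P))
      = ((of_int A - of_int P) / (of_int B - of_int P) - of_int A / of_int B) / (of_int P :: rat)"
  proof -
    have "(of_int B :: rat) \<noteq> of_int P" using assms by (simp only: of_int_eq_iff P_def not_False_eq_True)
    then show ?thesis using P(2) \<open>B \<noteq> 0\<close> by (simp add: divide_simps) (simp add: algebra_simps)
  qed
  finally show ?thesis by (simp add: rat_cong_prime_power_def P)
qed

section \<open>The two term sequences and their recurrences\<close>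

text \<open>This is the central binomial coefficient \<open>2k\<close> over \<open>k\<close>,
  divided by \<open>4 ^ k\<close>.\<close>

definition half_ratio :: "nat \<Rightarrow> rat" where
  "half_ratio k = pochhammer (1/2) k / fact k"

definition three_halves_ratio :: "nat \<Rightarrow> rat" where
  "three_halves_ratio k = fact k / pochhammer (3/2) k"

lemma half_ratio_0 [simp]: "half_ratio 0 = 1"
  by (simp add: half_ratio_def)

lemma half_ratio_Suc: "half_ratio (Suc k) = half_ratio k * (of_int (2 * int k + 1) / of_int (2 * int k + 2))"
  by (simp add: half_ratio_def pochhammer_Suc field_simps)

lemma three_halves_ratio_Suc:
  "three_halves_ratio (Suc k) = three_halves_ratio k * (of_int (2 * int k + 2) / of_int (2 * int k + 3))"
proof -
  have "3/2 + of_nat k \<noteq> (0::rat)" "(3 + of_nat k * 2) \<noteq> (0::rat)"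
    by (metis add_pos_nonneg less_numeral_extra(3) of_nat_0_le_iff zero_less_divide_iff zero_less_numeral)
      (metis add_pos_nonneg less_numeral_extra(3) of_nat_0_le_iff mult_nonneg_nonneg zero_le_numeral zero_less_numeral)
  then show ?thesis by (simp add: three_halves_ratio_def pochhammer_Suc divide_simps algebra_simps)
qed

lemma half_ratio_pos: "half_ratio k > 0"
  by (simp add: half_ratio_def pochhammer_pos)

text \<open>Both splittings of \<open>pochhammer (1/2) (Suc k)\<close>, at its first and at its last
  factor, are compared.\<close>

lemma three_halves_ratio_eq: "three_halves_ratio k = 1 / (of_int (2 * int k + 1) * half_ratio k)"
proof -
  have "1/2 * pochhammer (3/2) k = pochhammer (1/2) k * (1/2 + of_nat k :: rat)"
    using pochhammer_rec[of "1/2 :: rat" k] pochhammer_Suc[of "1/2 :: rat" k] by simp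
  then have "pochhammer (3/2) k = of_int (2 * int k + 1) * pochhammer (1/2 :: rat) k"
    by (simp add: algebra_simps)
  then show ?thesis by (simp add: three_halves_ratio_def half_ratio_def)
qed

section \<open>Divisibility by \<open>p\<close> of the individual terms\<close>

context
  fixes p n :: nat
  assumes prime: "prime p" and p_eq: "p = 2 * n + 1"
begin

lemma p_pos: "p > 0"
  by (simp add: p_eq)

text \<open>The only multiple of \<open>p\<close> strictly between 0 and \<open>2 * p\<close> is
  \<open>p\<close> itself; the factors \<open>2k+1\<close> and \<open>2k+2\<close> of the
  recurrences are kept in this range.\<close>

lemma coprime_p_if_small: "0 < m \<Longrightarrow> m < 2 * int p \<Longrightarrow> m \<noteq> int p \<Longrightarrow> coprime m (int p)"
proof -
  assume m: "0 < m" "m < 2 * int p" "m \<noteq> int p"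
  have "\<not> int p dvd m"
  proof
    assume "int p dvd m"
    then obtain k where k: "m = int p * k" by (elim dvdE)
    have "0 < k" using m(1) k p_pos by (simp add: zero_less_mult_iff)
    moreover have "k < 2" using m(2) k p_pos by (simp add: mult.commute)
    ultimately have "k = 1" by simp
    with k m(3) show False by simp
  qed
  then have "coprime (int p) m" using prime by (intro prime_imp_coprime) auto
  then show ?thesis by (simp add: coprime_commute)
qed

lemma p_integral_half_ratio: "k < p \<Longrightarrow> p_integral p (half_ratio k)"
proof (induction k)
  case (Suc k)
  have "coprime (2 * int k + 2) (int p)"
    using Suc.prems p_eq by (intro coprime_p_if_small) presburger+
  then show ?case using Suc unfolding half_ratio_Suc
    by (intro p_integral_mult p_integral_fraction) auto
qed simp

lemma p_integral_inverse_half_ratio: "k \<le> n \<Longrightarrow> p_integral p (1 / half_ratio k)"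
proof (induction k)
  case (Suc k)
  have "coprime (2 * int k + 1) (int p)"
    using Suc.prems p_eq by (intro coprime_p_if_small) presburger+
  then have "p_integral p (1 / half_ratio k * (of_int (2 * int k + 2) / of_int (2 * int k + 1)))"
    using Suc by (intro p_integral_mult p_integral_fraction) auto
  then show ?case by (simp add: half_ratio_Suc)
qed simp

text \<open>The numerator \<open>2n+1 = p\<close> enters in the step from \<open>n\<close> to
  \<open>n+1\<close>. Later denominators are even and below \<open>2 * p\<close>, hence never cancel
  it.\<close>

lemma half_ratio_cong_0:
  assumes "n < k" "k < p"
  shows "rat_cong_prime_power p 1 (half_ratio k) 0"
proof -
  from assms(1) have "Suc n \<le> k" by simp
  then have "k < p \<longrightarrow> p_integral p (half_ratio k / of_nat p)"
  proof (induction k rule: dec_induct)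
    case base
    show ?case
    proof
      assume "Suc n < p"
      then have "coprime (2 * int n + 2) (int p)"
        using p_eq by (intro coprime_p_if_small) presburger+
      then have "p_integral p (half_ratio n * (of_int 1 / of_int (2 * int n + 2)))"
        using \<open>Suc n < p\<close> by (intro p_integral_mult p_integral_fraction p_integral_half_ratio) auto
      also have "half_ratio n * (of_int 1 / of_int (2 * int n + 2)) = half_ratio (Suc n) / of_nat p"
      proof -
        have "of_int (2 * int n + 1) = (of_nat p :: rat)" by (simp add: p_eq)
        then show ?thesis using p_pos unfolding half_ratio_Suc by simp
      qed
      finally show "p_integral p (half_ratio (Suc n) / of_nat p)" .
    qed
  next
    case (step k)
    show ?case
    proof
      assume k: "Suc k < p"
      then have "coprime (2 * int k + 2) (int p)"
        using p_eq by (intro coprime_p_if_small) presburger+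
      then have "p_integral p (half_ratio k / of_nat p * (of_int (2 * int k + 1) / of_int (2 * int k + 2)))"
        using step k by (intro p_integral_mult p_integral_fraction) auto
      then show "p_integral p (half_ratio (Suc k) / of_nat p)" by (simp add: half_ratio_Suc mult_ac)
    qed
  qed
  then show ?thesis using assms(2) by (simp add: rat_cong_prime_power_def)
qed

lemma p_integral_three_halves_ratio:
  assumes "k < n"
  shows "p_integral p (three_halves_ratio k)"
proof -
  have "coprime (2 * int k + 1) (int p)"
    using assms p_eq by (intro coprime_p_if_small) presburger+
  then have "p_integral p (of_int 1 / of_int (2 * int k + 1) * (1 / half_ratio k))"
    using assms by (intro p_integral_mult p_integral_fraction p_integral_inverse_half_ratio) auto
  then show ?thesis by (simp add: three_halves_ratio_eq)
qed

section \<open>Reflection \<open>i\<close> to \<open>n - i\<close> and the termwise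
  congruences\<close>

text \<open>This is the recurrence run backwards: for \<open>k = n - Suc i\<close>, the numbers
  \<open>2i+1-p\<close> and \<open>2i+2-p\<close> are \<open>-(2k+2)\<close> and
  \<open>-(2k+1)\<close>.\<close>

lemma half_ratio_reflect:
  assumes "i < n"
  shows "half_ratio (n - Suc i) =
    half_ratio (n - i) * ((of_int (2 * int i + 1) - of_nat p) / (of_int (2 * int i + 2) - of_nat p))"
proof -
  define k where "k = n - Suc i"
  have k: "n - i = Suc k" "n = Suc k + i" using assms by (auto simp: k_def)
  have shift: "(of_int (2 * int i + 1) - of_nat p :: rat) = - of_int (2 * int k + 2)"
    "(of_int (2 * int i + 2) - of_nat p :: rat) = - of_int (2 * int k + 1)"
    using p_eq k(2) by simp_all
  have cancel: "h = h * (y / x) * (- x / - y)" if "x \<noteq> 0" "y \<noteq> 0" for h x y :: rat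
    using that by simp
  show ?thesis
    unfolding k(1) k_def[symmetric] half_ratio_Suc shift
    by (rule cancel) (simp_all only: of_int_eq_0_iff)
qed

text \<open>Modulo \<open>p\<close> the shifts by \<open>p\<close> drop out, so the reflected
  sequence obeys the original recurrence, with starting value \<open>half_ratio n\<close> instead of
  1.\<close>

lemma half_ratio_reflect_cong:
  "i \<le> n \<Longrightarrow> rat_cong_prime_power p 1 (half_ratio (n - i)) (half_ratio n * half_ratio i)"
proof (induction i)
  case (Suc i)
  have c: "coprime (2 * int i + 2) (int p)"
    using Suc.prems p_eq by (intro coprime_p_if_small) presburger+
  have "rat_cong_prime_power p 1
      ((of_int (2 * int i + 1) - of_nat p ^ 1) / (of_int (2 * int i + 2) - of_nat p ^ 1))
      (of_int (2 * int i + 1) / of_int (2 * int i + 2))"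
    using Suc.prems p_eq by (intro rat_cong_prime_power_shifted_fraction c p_pos) auto
  moreover have "p_integral p (of_int (2 * int i + 1) / of_int (2 * int i + 2))"
    by (intro p_integral_fraction c) simp
  moreover have "p_integral p (half_ratio n * half_ratio i)"
    using Suc.prems p_eq by (intro p_integral_mult p_integral_half_ratio) auto
  ultimately have "rat_cong_prime_power p 1
      (half_ratio (n - i) * ((of_int (2 * int i + 1) - of_nat p ^ 1) / (of_int (2 * int i + 2) - of_nat p ^ 1)))
      (half_ratio n * half_ratio i * (of_int (2 * int i + 1) / of_int (2 * int i + 2)))"
    using Suc by (intro rat_cong_prime_power_mult p_pos) auto
  then show ?case using Suc.prems half_ratio_reflect[of i] by (simp add: half_ratio_Suc mult.assoc)
qed simp

lemma half_ratio_square_reflect_cong: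
  assumes "i \<le> n"
  shows "rat_cong_prime_power p 1 ((half_ratio (n - i))\<^sup>2) ((half_ratio i)\<^sup>2)"
proof -
  have int: "p_integral p (half_ratio j)" if "j \<le> n" for j
    using that p_eq by (intro p_integral_half_ratio) auto
  have "rat_cong_prime_power p 1 ((half_ratio (n - i))\<^sup>2) ((half_ratio n * half_ratio i)\<^sup>2)"
    unfolding power2_eq_square using assms
    by (intro rat_cong_prime_power_mult half_ratio_reflect_cong p_pos p_integral_mult int) auto
  also have "rat_cong_prime_power p 1 ((half_ratio n * half_ratio i)\<^sup>2) (1 * (half_ratio i)\<^sup>2)"
    unfolding power_mult_distrib
  proof (intro rat_cong_prime_power_mult p_pos)
    \<comment> \<open>Reflecting at \<open>i = n\<close> compares \<open>half_ratio 0 = 1\<close>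
      with \<open>half_ratio n * half_ratio n\<close>.\<close>
    show "rat_cong_prime_power p 1 ((half_ratio n)\<^sup>2) 1"
      using rat_cong_prime_power_sym[OF half_ratio_reflect_cong[of n]] by (simp add: power2_eq_square)
  qed (use assms int in auto)
  finally show ?thesis by simp
qed

lemma three_halves_ratio_half_ratio_cong:
  "i \<le> n \<Longrightarrow> rat_cong_prime_power p 2
     (of_nat p * three_halves_ratio (n + i) * half_ratio (n - i)) ((half_ratio i)\<^sup>2)"
proof (induction i)
  case 0
  have "of_int (2 * int n + 1) = (of_nat p :: rat)" by (simp add: p_eq)
  then have "of_nat p * three_halves_ratio n * half_ratio n = 1"
    using p_pos half_ratio_pos[of n] unfolding three_halves_ratio_eq by simp
  then show ?case by simp
next
  case (Suc i)
  let ?A = "2 * int i + 1" and ?B = "2 * int i + 2"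
  have c: "coprime ?B (int p)"
    using Suc.prems p_eq by (intro coprime_p_if_small) presburger+
  \<comment> \<open>This ensures that the shifted denominator \<open>?B\<^sup>2 - p\<^sup>2\<close>
    is nonzero.\<close>
  have "?B < int p" using Suc.prems p_eq by simp
  then have "?B ^ 2 < int p ^ 2" by (intro power_strict_mono) auto
  then have "rat_cong_prime_power p 2
      ((of_int (?A\<^sup>2) - of_nat p ^ 2) / (of_int (?B\<^sup>2) - of_nat p ^ 2)) (of_int (?A\<^sup>2) / of_int (?B\<^sup>2))"
    using c by (intro rat_cong_prime_power_shifted_fraction p_pos) auto
  moreover have "p_integral p (of_int (?A\<^sup>2) / of_int (?B\<^sup>2))"
    using c by (intro p_integral_fraction) auto
  moreover have "p_integral p ((half_ratio i)\<^sup>2)"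
    using Suc.prems p_eq by (intro p_integral_power p_integral_half_ratio) auto
  ultimately have "rat_cong_prime_power p 2
      (of_nat p * three_halves_ratio (n + i) * half_ratio (n - i)
         * ((of_int (?A\<^sup>2) - of_nat p ^ 2) / (of_int (?B\<^sup>2) - of_nat p ^ 2)))
      ((half_ratio i)\<^sup>2 * (of_int (?A\<^sup>2) / of_int (?B\<^sup>2)))"
    using Suc by (intro rat_cong_prime_power_mult p_pos) auto
  moreover have "of_nat p * three_halves_ratio (n + i) * half_ratio (n - i)
         * ((of_int (?A\<^sup>2) - of_nat p ^ 2) / (of_int (?B\<^sup>2) - of_nat p ^ 2))
      = of_nat p * three_halves_ratio (n + Suc i) * half_ratio (n - Suc i)"
  proof -
    \<comment> \<open>The forward ratio has the shift \<open>+p\<close> and the reflected one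
      \<open>-p\<close>; their product involves \<open>p\<close> only through
      \<open>p\<^sup>2\<close>, which lifts the congruence from \<open>p\<close> to
      \<open>p\<^sup>2\<close>.\<close>
    have "of_int (2 * int (n + i) + 2) = of_int ?A + (of_nat p :: rat)"
      "of_int (2 * int (n + i) + 3) = of_int ?B + (of_nat p :: rat)"
      by (simp_all add: p_eq)
    moreover have "(of_int (x\<^sup>2) - of_nat p ^ 2 :: rat) = (of_int x + of_nat p) * (of_int x - of_nat p)" for x
      by (simp add: power2_eq_square algebra_simps)
    moreover have "x * t * h * (a * b / (c * d)) = x * (t * (a / c)) * (h * (b / d))"
      for a b c d x t h :: rat by (simp add: mult_ac)
    ultimately show ?thesis
      using Suc.prems by (simp only: add_Suc_right three_halves_ratio_Suc half_ratio_reflect Suc_le_eq)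
  qed
  ultimately show ?case by (simp add: half_ratio_Suc power_mult_distrib power_divide)
qed

text \<open>
  With \<open>u = (half_ratio i)\<^sup>2\<close>, \<open>v = (half_ratio (n - i))\<^sup>2\<close> and \<open>w\<close> the left-hand side of the congruence,
  \<open>w v \<equiv> u\<^sup>2\<close> modulo \<open>p\<^sup>2\<close> and \<open>u \<equiv> v\<close> modulo \<open>p\<close>, so
  \<open>(w - (2 u - v)) v = (w v - u\<^sup>2) + (u - v)\<^sup>2\<close> vanishes modulo \<open>p\<^sup>2\<close>.
\<close>
lemma three_halves_ratio_square_cong:
  assumes "i \<le> n"
  shows "rat_cong_prime_power p 2 ((of_nat p * three_halves_ratio (n + i))\<^sup>2)
     (2 * (half_ratio i)\<^sup>2 - (half_ratio (n - i))\<^sup>2)"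
proof -
  define u v w where "u = (half_ratio i)\<^sup>2" and "v = (half_ratio (n - i))\<^sup>2"
    and "w = (of_nat p * three_halves_ratio (n + i))\<^sup>2"
  have "p_integral p u"
    using assms p_eq unfolding u_def by (intro p_integral_power p_integral_half_ratio) auto
  have "p_integral p ((1 / half_ratio (n - i))\<^sup>2)"
    by (intro p_integral_power p_integral_inverse_half_ratio) simp
  then have v: "p_integral p (1 / v)" by (simp add: v_def power_divide)
  have "v \<noteq> 0" using half_ratio_pos[of "n - i"] by (simp add: v_def)
  have "rat_cong_prime_power p 2 ((of_nat p * three_halves_ratio (n + i) * half_ratio (n - i)) *
      (of_nat p * three_halves_ratio (n + i) * half_ratio (n - i))) (u * u)"
    using three_halves_ratio_half_ratio_cong[OF assms] \<open>p_integral p u\<close> unfolding u_def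
    by (intro rat_cong_prime_power_mult p_pos)
  then have wv: "p_integral p ((w * v - u\<^sup>2) / of_nat p ^ 2)"
    by (simp add: rat_cong_prime_power_def w_def v_def power2_eq_square mult_ac)
  have uv: "p_integral p ((v - u) / of_nat p)"
    using half_ratio_square_reflect_cong[OF assms] by (simp add: rat_cong_prime_power_def u_def v_def)
  have "p_integral p (((w * v - u\<^sup>2) / of_nat p ^ 2 + ((v - u) / of_nat p)\<^sup>2) * (1 / v))"
    by (intro p_integral_mult p_integral_add p_integral_power wv uv v)
  also have "((w * v - u\<^sup>2) / of_nat p ^ 2 + ((v - u) / of_nat p)\<^sup>2) * (1 / v)
      = (w - (2 * u - v)) / of_nat p ^ 2"
    using \<open>v \<noteq> 0\<close> p_pos by (simp add: field_simps power2_eq_square)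
  finally show ?thesis by (simp add: rat_cong_prime_power_def u_def v_def w_def)
qed

section \<open>Congruences between the sums\<close>

text \<open>For \<open>n < k < p\<close> the ratio is divisible by \<open>p\<close>, so its square
  vanishes modulo \<open>p\<^sup>2\<close>.\<close>

lemma half_ratio_sum_cong:
  "rat_cong_prime_power p 2 (\<Sum>k=0..p-1. (half_ratio k)\<^sup>2 * (-1) ^ k) (\<Sum>k=0..n. (half_ratio k)\<^sup>2 * (-1) ^ k)"
proof -
  have "(\<Sum>k=0..n. (half_ratio k)\<^sup>2 * (-1) ^ k)
      = (\<Sum>k=0..p-1. if k \<le> n then (half_ratio k)\<^sup>2 * (-1) ^ k else 0)"
    by (rule sum.mono_neutral_cong_left) (auto simp: p_eq)
  moreover have "rat_cong_prime_power p 2 ((half_ratio k)\<^sup>2 * (-1) ^ k)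
      (if k \<le> n then (half_ratio k)\<^sup>2 * (-1) ^ k else 0)" if "k \<in> {0..p-1}" for k
  proof (cases "k \<le> n")
    case False
    then have "rat_cong_prime_power p 2 ((half_ratio k)\<^sup>2) 0"
      using that p_pos by (intro rat_cong_prime_power_square_0 half_ratio_cong_0) auto
    then have "rat_cong_prime_power p 2 ((half_ratio k)\<^sup>2 * (-1) ^ k) (0 * (-1) ^ k)"
      by (intro rat_cong_prime_power_mult p_pos p_integral_power p_integral_minus) auto
    then show ?thesis using False by simp
  qed simp
  ultimately show ?thesis by (simp only: rat_cong_prime_power_sum)
qed

text \<open>For \<open>k < n\<close> the terms are \<open>p\<close>-integral, and the prefactor
  \<open>p\<^sup>2\<close> kills them.\<close>

lemma three_halves_ratio_sum_cong:
  "rat_cong_prime_power p 2 (of_nat p ^ 2 * (\<Sum>k=0..p-1. (three_halves_ratio k)\<^sup>2 * (-1) ^ k))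
     (of_nat p ^ 2 * (\<Sum>k=n..p-1. (three_halves_ratio k)\<^sup>2 * (-1) ^ k))"
proof -
  have "rat_cong_prime_power p 2 (\<Sum>k=0..p-1. of_nat p ^ 2 * ((three_halves_ratio k)\<^sup>2 * (-1) ^ k))
      (\<Sum>k=0..p-1. if n \<le> k then of_nat p ^ 2 * ((three_halves_ratio k)\<^sup>2 * (-1) ^ k) else 0)"
  proof (rule rat_cong_prime_power_sum)
    fix k
    show "rat_cong_prime_power p 2 (of_nat p ^ 2 * ((three_halves_ratio k)\<^sup>2 * (-1) ^ k))
      (if n \<le> k then of_nat p ^ 2 * ((three_halves_ratio k)\<^sup>2 * (-1) ^ k) else 0)"
    proof (cases "n \<le> k")
      case False
      then have "p_integral p ((three_halves_ratio k)\<^sup>2 * (-1) ^ k)"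
        by (intro p_integral_mult p_integral_power p_integral_minus p_integral_three_halves_ratio) auto
      then show ?thesis using False p_pos by (simp add: rat_cong_prime_power_def)
    qed simp
  qed
  also have "(\<Sum>k=0..p-1. if n \<le> k then of_nat p ^ 2 * ((three_halves_ratio k)\<^sup>2 * (-1) ^ k) else 0)
      = (\<Sum>k=n..p-1. of_nat p ^ 2 * ((three_halves_ratio k)\<^sup>2 * (-1) ^ k))"
    by (rule sum.mono_neutral_cong_right) (auto simp: p_eq)
  finally show ?thesis by (simp only: sum_distrib_left)
qed

lemma three_halves_half_sum_cong:
  assumes "even n"
  shows "rat_cong_prime_power p 2 (of_nat p ^ 2 * (\<Sum>k=n..p-1. (three_halves_ratio k)\<^sup>2 * (-1) ^ k))
     (\<Sum>k=0..n. (half_ratio k)\<^sup>2 * (-1) ^ k)"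
proof -
  have "of_nat p ^ 2 * (\<Sum>k=n..p-1. (three_halves_ratio k)\<^sup>2 * (-1) ^ k)
      = (\<Sum>k=n..p-1. (of_nat p * three_halves_ratio k)\<^sup>2 * (-1) ^ k)"
    by (simp only: sum_distrib_left power_mult_distrib mult.assoc)
  also have "\<dots> = (\<Sum>i=0..n. (of_nat p * three_halves_ratio (n + i))\<^sup>2 * (-1) ^ (n + i))"
    by (rule sum.reindex_bij_witness[of _ "\<lambda>i. n + i" "\<lambda>k. k - n"]) (auto simp: p_eq)
  also have "\<dots> = (\<Sum>i=0..n. (of_nat p * three_halves_ratio (n + i))\<^sup>2 * (-1) ^ i)"
    using assms by (simp add: power_add)
  also have "rat_cong_prime_power p 2 \<dots>
      (\<Sum>i=0..n. (2 * (half_ratio i)\<^sup>2 - (half_ratio (n - i))\<^sup>2) * (-1) ^ i)"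
  proof (intro rat_cong_prime_power_sum rat_cong_prime_power_mult p_pos three_halves_ratio_square_cong)
    fix i assume "i \<in> {0..n}"
    then show "p_integral p (2 * (half_ratio i)\<^sup>2 - (half_ratio (n - i))\<^sup>2)"
      using p_eq by (intro p_integral_diff p_integral_mult p_integral_power p_integral_half_ratio) auto
  qed (auto intro!: p_integral_power p_integral_minus)
  also have "(\<Sum>i=0..n. (2 * (half_ratio i)\<^sup>2 - (half_ratio (n - i))\<^sup>2) * (-1) ^ i)
      = 2 * (\<Sum>i=0..n. (half_ratio i)\<^sup>2 * (-1) ^ i) - (\<Sum>i=0..n. (half_ratio (n - i))\<^sup>2 * (-1) ^ i)"
    by (simp add: left_diff_distrib sum_subtractf sum_distrib_left mult.assoc)
  \<comment> \<open>Since \<open>n\<close> is even, \<open>i\<close> and \<open>n - i\<close> have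
    the same parity, so reversal keeps the signs and the total is twice the sum minus the sum
    itself.\<close>
  also have "(\<Sum>i=0..n. (half_ratio (n - i))\<^sup>2 * (-1) ^ i) = (\<Sum>i=0..n. (half_ratio i)\<^sup>2 * (-1) ^ i)"
    by (rule sum.reindex_bij_witness[of _ "\<lambda>i. n - i" "\<lambda>i. n - i"])
      (use assms in \<open>auto simp: minus_one_power_iff\<close>)
  finally show ?thesis by simp
qed

end

theorem theorem2p25:
  fixes p :: nat
  assumes "prime p" and "[p = 1] (mod 4)"
  shows "rat_cong_prime_power p 2
           (trunc_hypergeo [1/2, 1/2] [1] (-1) (p - 1))
           (of_nat p ^ 2 * trunc_hypergeo [1, 1, 1] [3/2, 3/2] (-1) (p - 1))
       \<and> rat_cong_prime_power p 2
           (\<Sum>k=0..p-1. (pochhammer (1/2) k / fact k) ^ 2 * (-1) ^ k)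
           (of_nat p ^ 2 * (\<Sum>k=(p-1) div 2..p-1. (fact k / pochhammer (3/2) k) ^ 2 * (-1) ^ k))"
proof -
  define n where "n = (p - 1) div 2"
  have "p mod 4 = 1" using assms(2) by (simp add: cong_def)
  then have p: "p = 2 * n + 1" and "even n" unfolding n_def by presburger+
  \<comment> \<open>As \<open>pochhammer 1 k = fact k\<close>, the lower parameter 1 and the
    \<open>fact k\<close> of the series supply the squared denominator.\<close>
  have half: "trunc_hypergeo [1/2, 1/2] [1] (-1) (p - 1) = (\<Sum>k=0..p-1. (half_ratio k)\<^sup>2 * (-1) ^ k)"
    by (simp add: trunc_hypergeo_def half_ratio_def pochhammer_fact[symmetric] power2_eq_square)
  \<comment> \<open>One of the three upper parameters 1 cancels the \<open>fact k\<close> of the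
    series; the other two give the square.\<close>
  have three: "trunc_hypergeo [1, 1, 1] [3/2, 3/2] (-1) (p - 1) = (\<Sum>k=0..p-1. (three_halves_ratio k)\<^sup>2 * (-1) ^ k)"
    by (simp add: trunc_hypergeo_def three_halves_ratio_def pochhammer_fact[symmetric] power2_eq_square mult.assoc)
  have second: "rat_cong_prime_power p 2 (\<Sum>k=0..p-1. (half_ratio k)\<^sup>2 * (-1) ^ k)
      (of_nat p ^ 2 * (\<Sum>k=n..p-1. (three_halves_ratio k)\<^sup>2 * (-1) ^ k))"
    using half_ratio_sum_cong[OF assms(1) p] three_halves_half_sum_cong[OF assms(1) p \<open>even n\<close>]
    by (blast intro: rat_cong_prime_power_trans rat_cong_prime_power_sym)
  then have "rat_cong_prime_power p 2 (\<Sum>k=0..p-1. (half_ratio k)\<^sup>2 * (-1) ^ k)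
      (of_nat p ^ 2 * (\<Sum>k=0..p-1. (three_halves_ratio k)\<^sup>2 * (-1) ^ k))"
    using three_halves_ratio_sum_cong[OF assms(1) p]
    by (blast intro: rat_cong_prime_power_trans rat_cong_prime_power_sym)
  with second show ?thesis
    unfolding half three by (simp add: half_ratio_def three_halves_ratio_def n_def)
qed

end
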